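(* For every integer $n\ge1$, the competition complexity of the VCG auction in the $n$-unit, $n$-buyer balanced market over the class of MHR distributions $\mathcal F_{\mathrm{MHR}}$ coincides with the competition complexity over the subclass of truncated exponential distributions $\mathcal F_{\mathrm{TEXP}}\subsetneq\mathcal F_{\mathrm{MHR}}$: $$\mathrm{CC}(n,\mathcal F_{\mathrm{MHR}})=\mathrm{CC}(n,\mathcal F_{\mathrm{TEXP}}).$$
   Context: Distributions. A valuation distribution $F$ is a probability distribution on $[0,\infty)$; $F$ also denotes its CDF with the convention $F(v)=\Pr_{x\sim F}[x<v]$. Its support is an interval on which it has a density $f$, except that an atom at the right endpoint of the support is allowed (in particular point masses are allowed). It is assumed that some price $p\in\mathrm{supp}(F)$ maximizes $p\,(1-F(p))$ over $p\ge 0$; such a maximizer is called a monopoly reserve $r^*$. $F$ is MHR (monotone hazard rate) if the hazard rate $f(v)/(1-F(v))$ is non-decreasing in $v$ on the support (excluding the possible atom at its right endpoint). $\mathcal F_{\mathrm{MHR}}$ is the class of MHR distributions. For $r\in[1,e]$ the $r$-truncated exponential distribution $F_{(0,r)}$ has CDF (same convention) $F_{(0,r)}(v)=1-r^{-v/r}$ for $v\in[0,r]$ and $F_{(0,r)}(v)=1$ for $v>r$; it has an atom of mass $1/r$ at $r$. $\mathcal F_{\mathrm{TEXP}}=\{F_{(0,r)}:r\in[1,e]\}$. Mechanisms. In an $m$-unit, $N$-buyer market ($m\le N$) the buyers have unit demand and values drawn i.i.d. from $F$; all bid truthfully. The VCG auction gives one unit to each of the $m$ highest-valued buyers (ties broken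 arbitrarily) and each winner pays the $(m+1)$-th highest value (taken to be $0$ if $N=m$). $\mathrm{RevVCG}_{m:N}(F)$ is its expected total payment. The Bayesian-optimal mechanism with monopoly reserve $r^*$ gives one unit to each of the $m$ highest-valued buyers whose value is at least $r^*$; each winner pays the maximum of $r^*$ and the $(m+1)$-th highest value. $\mathrm{RevOPT}_{m:N}(F)$ is its expected total payment (for $m=N$ it equals $N\cdot\max_p p(1-F(p))$). Competition complexity. $\mathrm{CC}(n,\mathcal F)=\min\{k\in\mathbb Z_{\ge 0}:\ \forall F\in\mathcal F,\ \mathrm{RevVCG}_{n:n+k}(F)\ge \mathrm{RevOPT}_{n:n}(F)\}$ (and $\infty$ if no such $k$ exists). *)

theory Defs
  imports "HOL-Probability.Probability" "HOL-Library.Extended_Nat"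
begin

section \<open>Valuation distributions\<close>

text \<open>The CDF convention is \<open>F(v) = Pr[x < v]\<close>, i.e. the left-continuous version
  (the library's \<open>cdf\<close> is \<open>Pr[x \<le> v]\<close>); hence \<open>1 - F(p) = Pr[x \<ge> p]\<close> is the
  probability of a sale at price \<open>p\<close>.\<close>

definition lcdf :: "real measure \<Rightarrow> real \<Rightarrow> real" where
  "lcdf F v = measure F {..<v}"

definition supp :: "real measure \<Rightarrow> real set" where
  "supp F = {x. \<forall>U. open U \<and> x \<in> U \<longrightarrow> emeasure F U > 0}"

text \<open>The support is closed, so it contains its right endpoint if it is bounded. This endpoint,
  where an atom is allowed, is removed in \<open>supp_body\<close>, which is empty for a point mass.\<close>

definition supp_body :: "real measure \<Rightarrow> real set" where
  "supp_body F = {x \<in> supp F. \<exists>y \<in> supp F. x < y}"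

definition is_supp_density :: "real measure \<Rightarrow> (real \<Rightarrow> real) \<Rightarrow> bool" where
  "is_supp_density F f \<longleftrightarrow>
     f \<in> borel_measurable borel \<and> (\<forall>x. 0 \<le> f x) \<and>
     (\<forall>A \<in> sets borel. A \<subseteq> supp_body F \<longrightarrow>
        emeasure F A = (\<integral>\<^sup>+ x \<in> A. ennreal (f x) \<partial>lborel))"

definition monopoly_reserve :: "real measure \<Rightarrow> real \<Rightarrow> bool" where
  "monopoly_reserve F r \<longleftrightarrow>
     r \<in> supp F \<and> (\<forall>p \<ge> 0. p * (1 - lcdf F p) \<le> r * (1 - lcdf F r))"

definition valuation_distribution :: "real measure \<Rightarrow> bool" where
  "valuation_distribution F \<longleftrightarrow>
     real_distribution F \<and> (AE x in F. 0 \<le> x) \<and>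
     is_interval (supp F) \<and> (\<exists>f. is_supp_density F f) \<and> (\<exists>r. monopoly_reserve F r)"

text \<open>A density is determined only almost everywhere, so we ask for a version of it whose hazard
  rate is monotone. The right endpoint of the support is always left out, also if it is not
  an atom; in that case \<open>1 - F\<close> vanishes there.\<close>

definition MHR :: "real measure set" where
  "MHR = {F. valuation_distribution F \<and>
     (\<exists>f. is_supp_density F f \<and> mono_on (supp_body F) (\<lambda>v. f v / (1 - lcdf F v)))}"

text \<open>Being supported on the non-negative reals follows from the formula at \<open>v = 0\<close>.\<close>

definition is_texp :: "real \<Rightarrow> real measure \<Rightarrow> bool" where
  "is_texp r F \<longleftrightarrow>
     real_distribution F \<and>
     (\<forall>v \<in> {0..r}. lcdf F v = 1 - r powr (- v / r)) \<and> (\<forall>v > r. lcdf F v = 1)"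

definition TEXP :: "real measure set" where
  "TEXP = {F. \<exists>r \<in> {1..exp 1}. is_texp r F}"

lemma ex_texp:
  assumes "1 \<le> r"
  shows "\<exists>F. is_texp r F"
proof -
  define U :: "real measure" where "U = uniform_measure lborel {0..1}"
  define X where "X u = (if u \<le> 1 / r \<or> r = 1 then r else - r * ln u / ln r)" for u :: real
  define F where "F = distr U borel X"
  interpret U: prob_space U
    unfolding U_def by (rule prob_space_uniform_measure) auto
  have [measurable]: "X \<in> borel_measurable U"
    unfolding X_def U_def by measurable
  have sU: "space U = UNIV" by (simp add: U_def)
  interpret F: real_distribution F
    unfolding F_def by (rule U.real_distribution_distr) simp
  have cdf: "lcdf F v = measure lborel ({0..1} \<inter> {u. X u < v})" for v
  proof -
    have "lcdf F v = measure U {u. X u < v}"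
      unfolding lcdf_def F_def by (subst measure_distr) (auto simp: sU vimage_def)
    moreover have "{u. X u < v} \<in> sets lborel"
      unfolding X_def by measurable
    ultimately show ?thesis
      unfolding U_def by (simp add: measure_uniform_measure)
  qed
  have le: "lcdf F v = 1 - r powr (- v / r)" if v: "v \<in> {0..r}" for v
  proof -
    have p1: "r powr (- v / r) \<le> 1"
      using assms v by (simp add: powr_le_one_le powr_minus_divide ge_one_powr_ge_zero)
    have pr: "1 / r \<le> r powr (- v / r)"
      using assms v powr_mono[of "-1" "- v / r" r] by (simp add: powr_minus_divide)
    have "{0..1} \<inter> {u. X u < v} = {r powr (- v / r)<..1}"
    proof (cases "r = 1")
      case True
      then show ?thesis using v by (auto simp: X_def)
    next
      case False
      then have r: "r > 1" "ln r > 0" using assms by auto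
      have "X u < v \<longleftrightarrow> r powr (- v / r) < u" if "u > 1 / r" for u
      proof -
        have u: "u > 0" using that r by (meson less_trans zero_less_divide_1_iff le_less_trans less_imp_le zero_less_one)
        have "X u < v \<longleftrightarrow> - v / r * ln r < ln u"
          using that r False by (auto simp: X_def field_simps)
        also have "\<dots> \<longleftrightarrow> r powr (- v / r) < u"
          using u r by (metis exp_less_cancel_iff exp_ln less_trans not_less_iff_gr_or_eq powr_def zero_less_one)
        finally show ?thesis .
      qed
      moreover have "\<not> X u < v" if "u \<le> 1 / r" for u
        using that v by (auto simp: X_def)
      ultimately show ?thesis using pr p1 assms
        by (auto simp: not_le) (smt (verit) powr_ge_zero)+
    qed
    then show ?thesis using p1 by (simp add: cdf)
  qed
  have gt: "lcdf F v = 1" if v: "v > r" for v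
  proof -
    have "X u \<le> r" for u
    proof (cases "u \<le> 1 / r \<or> r = 1")
      case False
      then have r: "r > 1" "ln r > 0" and u: "u > 1 / r" using assms by auto
      have "ln (1 / r) \<le> ln u" using u r by (subst ln_le_cancel_iff) (auto intro: less_trans[of 0 "1 / r"])
      then have "- ln u \<le> ln r" using r by (simp add: ln_div)
      then have "r * (- ln u) \<le> r * ln r" using r by (intro mult_left_mono) auto
      then show ?thesis using False r by (auto simp: X_def field_simps)
    qed (auto simp: X_def)
    then have "{0..1} \<inter> {u. X u < v} = {0..1}"
      using v by (auto intro: le_less_trans)
    then show ?thesis by (simp add: cdf)
  qed
  show ?thesis
    using le gt F.real_distribution_axioms unfolding is_texp_def by blast
qed


section \<open>Mechanisms\<close>

text \<open>A value profile is a function on the buyers \<open>0, \<dots>, N - 1\<close>. The descending list is indexed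
  from \<open>0\<close>, so its entry \<open>m\<close> is the \<open>(m+1)\<close>-th highest value, with multiplicity.\<close>

definition next_value :: "nat \<Rightarrow> nat \<Rightarrow> (nat \<Rightarrow> real) \<Rightarrow> real" where
  "next_value m N v = (if m < N then rev (sort (map v [0..<N])) ! m else 0)"

text \<open>Ties are broken in favour of the smaller index; the revenues below do not depend on this,
  since all winners pay the same price and, at ties, only the identity of the winners changes.\<close>

definition top_buyers :: "nat \<Rightarrow> nat \<Rightarrow> (nat \<Rightarrow> real) \<Rightarrow> nat set" where
  "top_buyers m N v =
     {i \<in> {..<N}. card {j \<in> {..<N}. v i < v j \<or> (v j = v i \<and> j < i)} < m}"

definition vcg_payment :: "nat \<Rightarrow> nat \<Rightarrow> (nat \<Rightarrow> real) \<Rightarrow> real" where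
  "vcg_payment m N v = (\<Sum>i \<in> top_buyers m N v. next_value m N v)"

definition opt_payment :: "nat \<Rightarrow> nat \<Rightarrow> real \<Rightarrow> (nat \<Rightarrow> real) \<Rightarrow> real" where
  "opt_payment m N r v =
     (\<Sum>i \<in> {i \<in> top_buyers m N v. r \<le> v i}. max r (next_value m N v))"

text \<open>Payments are almost surely non-negative, so expected payments are taken in \<open>[0, \<infinity>]\<close>.\<close>

definition RevVCG :: "nat \<Rightarrow> nat \<Rightarrow> real measure \<Rightarrow> ennreal" where
  "RevVCG m N F = (\<integral>\<^sup>+ v. ennreal (vcg_payment m N v) \<partial>(\<Pi>\<^sub>M i\<in>{..<N}. F))"

definition RevOPT :: "nat \<Rightarrow> nat \<Rightarrow> real \<Rightarrow> real measure \<Rightarrow> ennreal" where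
  "RevOPT m N r F = (\<integral>\<^sup>+ v. ennreal (opt_payment m N r v) \<partial>(\<Pi>\<^sub>M i\<in>{..<N}. F))"


section \<open>Competition complexity\<close>

text \<open>The optimal revenue is taken at an arbitrary monopoly reserve. One exists for every
  valuation distribution, and for \<open>n\<close> units and \<open>n\<close> buyers its choice does not matter. The infimum
  of the empty set is \<open>\<infinity>\<close>.\<close>

definition CC :: "nat \<Rightarrow> real measure set \<Rightarrow> enat" where
  "CC n \<F> = Inf (enat ` {k. \<forall>F \<in> \<F>. \<forall>r. monopoly_reserve F r \<longrightarrow>
                             RevVCG n (n + k) F \<ge> RevOPT n n r F})"

end

theory Submission
  imports Defs
begin

text \<open>Let \<open>F\<close> be MHR with monopoly reserve \<open>s\<close> and survival function \<open>S\<close>. Monotone hazard makes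
  \<open>- ln S(v) / v\<close> non-decreasing, so \<open>S(v) \<ge> S(s) powr (v / s)\<close> for \<open>0 < v \<le> s\<close>; together with
  the optimality of \<open>s\<close> this gives \<open>S(s) \<ge> 1 / e\<close>. Hence, with \<open>q = 1 / S(s) \<in> [1, e]\<close> and
  \<open>R = s S(s)\<close>, the distribution \<open>F\<close> stochastically dominates the \<open>q\<close>-truncated exponential
  distribution scaled by \<open>R\<close>. Both have balanced optimal revenue \<open>n R\<close>, whereas the VCG revenue is
  monotone under dominance (couple the values by quantiles), so a number of extra buyers that
  suffices for the truncated exponential distributions suffices for \<open>F\<close>.\<close>

section \<open>Revenues\<close>

text \<open>Under a strict total order the number of predecessors is an injective map of
  \<open>{..<N}\<close> into itself, hence a permutation, so exactly \<open>m\<close> elements have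
  rank below \<open>m\<close>. This counts the winners, ties included.\<close>

lemma card_rank_less:
  fixes prec :: "nat \<Rightarrow> nat \<Rightarrow> bool"
  assumes irrefl: "\<And>i. \<not> prec i i"
    and trans: "\<And>i j k. prec i j \<Longrightarrow> prec j k \<Longrightarrow> prec i k"
    and total: "\<And>i j. i \<noteq> j \<Longrightarrow> prec i j \<or> prec j i"
    and "m \<le> N"
  shows "card {i \<in> {..<N}. card {j \<in> {..<N}. prec j i} < m} = m"
proof -
  define rank where "rank i = card {j \<in> {..<N}. prec j i}" for i
  have less: "rank i < rank j" if "prec i j" "i < N" for i j
    unfolding rank_def
  proof (intro psubset_card_mono)
    have "i \<in> {k \<in> {..<N}. prec k j}" "i \<notin> {k \<in> {..<N}. prec k i}" using that irrefl by auto
    moreover have "{k \<in> {..<N}. prec k i} \<subseteq> {k \<in> {..<N}. prec k j}" using that trans by blast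
    ultimately show "{k \<in> {..<N}. prec k i} \<subset> {k \<in> {..<N}. prec k j}" by blast
  qed simp
  have "inj_on rank {..<N}"
    by (rule inj_onI) (metis lessThan_iff less less_irrefl total)
  moreover have "rank ` {..<N} \<subseteq> {..<N}"
  proof safe
    fix i assume "i < N"
    then have "rank i < card {..<N}"
      unfolding rank_def using irrefl by (intro psubset_card_mono) auto
    then show "rank i < N" by simp
  qed
  ultimately have bij: "bij_betw rank {..<N} {..<N}"
    by (simp add: bij_betw_def endo_inj_surj)
  have "rank ` {i \<in> {..<N}. rank i < m} = {..<m}"
  proof -
    have "rank ` {i \<in> {..<N}. rank i < m} = rank ` {..<N} \<inter> {..<m}" by auto
    then show ?thesis using bij \<open>m \<le> N\<close> by (auto simp: bij_betw_def)
  qed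
  moreover have "inj_on rank {i \<in> {..<N}. rank i < m}"
    using bij by (auto simp: bij_betw_def inj_on_def)
  ultimately have "card {i \<in> {..<N}. rank i < m} = card {..<m}"
    by (metis card_image)
  then show ?thesis by (simp add: rank_def)
qed

lemma card_top_buyers: "m \<le> N \<Longrightarrow> card (top_buyers m N v) = m"
  unfolding top_buyers_def by (rule card_rank_less) auto

lemma top_buyers_all: "top_buyers n n v = {..<n}"
proof (rule card_subset_eq)
  show "card (top_buyers n n v) = card {..<n}" by (simp add: card_top_buyers)
qed (auto simp: top_buyers_def)

lemma vcg_payment_eq: "m \<le> N \<Longrightarrow> vcg_payment m N v = real m * next_value m N v"
  by (simp add: vcg_payment_def card_top_buyers)

text \<open>Counting exceedances is invariant under sorting, so the sorted list can be forgotten.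
  Both the monotonicity and the measurability of \<open>next_value\<close> are read off from this
  count.\<close>

lemma next_value_le_iff:
  assumes "m < N"
  shows "next_value m N v \<le> x \<longleftrightarrow> card {i \<in> {..<N}. x < v i} \<le> m"
proof -
  define l where "l = rev (sort (map v [0..<N]))"
  have len: "length l = N" by (simp add: l_def)
  have dec: "l ! j \<le> l ! i" if "i \<le> j" "j < N" for i j
    using that len sorted_rev_nth_mono[of l i j] by (simp add: l_def)
  have "card {i \<in> {..<N}. x < v i} = length (filter (\<lambda>y. x < y) (map v [0..<N]))"
    by (simp add: length_filter_conv_card cong: conj_cong)
  also have "\<dots> = length (filter (\<lambda>y. x < y) l)"
    unfolding l_def by (metis mset_filter mset_rev mset_sort size_mset)
  also have "\<dots> = card {i. i < N \<and> x < l ! i}"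
    by (simp add: length_filter_conv_card len)
  finally have card: "card {i \<in> {..<N}. x < v i} = card {i. i < N \<and> x < l ! i}" .
  have "card {i. i < N \<and> x < l ! i} \<le> m" if "l ! m \<le> x"
  proof -
    have "{i. i < N \<and> x < l ! i} \<subseteq> {..<m}"
      using dec that by (auto simp: not_less) (meson leD le_less_trans not_less)
    then show ?thesis by (metis card_lessThan card_mono finite_lessThan)
  qed
  moreover have "card {i. i < N \<and> x < l ! i} > m" if "x < l ! m"
  proof -
    have "{..m} \<subseteq> {i. i < N \<and> x < l ! i}"
      using dec that assms by (auto intro: less_le_trans)
    then have "card {..m} \<le> card {i. i < N \<and> x < l ! i}" by (intro card_mono) auto
    then show ?thesis by simp
  qed
  ultimately show ?thesis
    using assms card by (auto simp: next_value_def l_def) (meson leD not_le)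
qed

lemma next_value_scale_le:
  assumes "c > 0" "\<And>i. i < N \<Longrightarrow> c * w i \<le> v i"
  shows "c * next_value m N w \<le> next_value m N v"
proof (cases "m < N")
  case True
  let ?x = "next_value m N v"
  \<comment> \<open>The order statistic of \<open>v\<close> itself serves as the threshold: every
    \<open>w i\<close> above \<open>?x / c\<close> forces \<open>v i\<close> above
    \<open>?x\<close>.\<close>
  have "{i \<in> {..<N}. ?x / c < w i} \<subseteq> {i \<in> {..<N}. ?x < v i}"
    using assms by (auto simp: field_simps) (metis less_le_trans mult.commute)
  then have "card {i \<in> {..<N}. ?x / c < w i} \<le> card {i \<in> {..<N}. ?x < v i}"
    by (intro card_mono) auto
  also have "\<dots> \<le> m" using next_value_le_iff[OF True] by blast
  finally show ?thesis
    using assms(1) next_value_le_iff[OF True, of w "?x / c"] by (simp add: field_simps)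
qed (simp add: next_value_def)

lemma next_value_measurable:
  "next_value m N \<in> borel_measurable (\<Pi>\<^sub>M i\<in>{..<N}. (borel :: real measure))"
proof (cases "m < N")
  case True
  show ?thesis
  proof (rule borel_measurableI_le)
    fix x
    have "card {i \<in> {..<N}. x < v i} = (\<Sum>i<N. if x < v i then 1 else 0)" for v :: "nat \<Rightarrow> real"
      by (simp add: sum.If_cases Int_def)
    then show "{v \<in> space (\<Pi>\<^sub>M i\<in>{..<N}. borel). next_value m N v \<le> x}
        \<in> sets (\<Pi>\<^sub>M i\<in>{..<N}. borel)"
      by (simp add: next_value_le_iff[OF True])
  qed
qed (simp add: next_value_def[abs_def])

section \<open>Expected revenues\<close>

lemma RevVCG_eq:
  assumes "m \<le> N" "sets F = sets borel"
  shows "RevVCG m N F = of_nat m * (\<integral>\<^sup>+ v. ennreal (next_value m N v) \<partial>(\<Pi>\<^sub>M i\<in>{..<N}. F))"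
proof -
  have [measurable]: "next_value m N \<in> borel_measurable (\<Pi>\<^sub>M i\<in>{..<N}. F)"
    using next_value_measurable[of m N] measurable_cong_sets[OF sets_PiM_cong] assms(2) by metis
  show ?thesis
    unfolding RevVCG_def
    by (simp add: vcg_payment_eq[OF assms(1)] ennreal_mult' ennreal_of_nat_eq_real_of_nat nn_integral_cmult)
qed

text \<open>With as many units as buyers everybody is a top buyer and the next value is the default
  \<open>0\<close>, so the mechanism posts the price \<open>r\<close> to each buyer. The expectation
  is then a sum over one-dimensional marginals.\<close>

lemma RevOPT_balanced:
  assumes "real_distribution F" "0 \<le> r"
  shows "RevOPT n n r F = ennreal (real n * (r * (1 - lcdf F r)))"
proof -
  interpret F: real_distribution F by fact
  have pay: "opt_payment n n r v = (\<Sum>i<n. r * indicator {r..} (v i))" for v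
  proof -
    have "opt_payment n n r v = (\<Sum>i\<in>{i\<in>{..<n}. r \<le> v i}. r)"
      using assms(2) by (simp add: opt_payment_def top_buyers_all next_value_def)
    also have "\<dots> = (\<Sum>i<n. if r \<le> v i then r else 0)"
      by (rule sum.inter_filter) simp
    also have "\<dots> = (\<Sum>i<n. r * indicator {r..} (v i))"
      by (intro sum.cong) auto
    finally show ?thesis .
  qed
  have "UNIV - {..<r} = {r..}" by auto
  then have meas: "measure F {r..} = 1 - lcdf F r"
    using F.prob_compl[of "{..<r}"] by (simp add: lcdf_def)
  have int: "(\<integral>\<^sup>+ v. ennreal (indicator {r..} (v i)) \<partial>(\<Pi>\<^sub>M i\<in>{..<n}. F)) = ennreal (1 - lcdf F r)"
    if "i < n" for i
  proof -
    have "(\<integral>\<^sup>+ v. ennreal (indicator {r..} (v i)) \<partial>(\<Pi>\<^sub>M i\<in>{..<n}. F))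
      = (\<integral>\<^sup>+ x. ennreal (indicator {r..} x) \<partial>distr (\<Pi>\<^sub>M i\<in>{..<n}. F) F (\<lambda>v. v i))"
      using that by (subst nn_integral_distr) auto
    also have "\<dots> = (\<integral>\<^sup>+ x. ennreal (indicator {r..} x) \<partial>F)"
      using that F.prob_space_axioms by (subst distr_PiM_component) auto
    also have "\<dots> = emeasure F {r..}" by (simp add: ennreal_indicator)
    finally show ?thesis by (simp add: F.emeasure_eq_measure meas)
  qed
  have "RevOPT n n r F
      = (\<integral>\<^sup>+ v. (\<Sum>i<n. ennreal r * ennreal (indicator {r..} (v i))) \<partial>(\<Pi>\<^sub>M i\<in>{..<n}. F))"
    unfolding RevOPT_def pay using assms(2)
    by (intro nn_integral_cong, subst sum_ennreal[symmetric])
       (simp, intro sum.cong refl ennreal_mult, simp_all)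
  also have "\<dots> = (\<Sum>i<n. ennreal r * ennreal (1 - lcdf F r))"
    by (subst nn_integral_sum) (auto simp: nn_integral_cmult int)
  also have "\<dots> = ennreal (real n * (r * (1 - lcdf F r)))"
    using assms(2) F.prob_le_1
    by (simp add: lcdf_def ennreal_mult ennreal_of_nat_eq_real_of_nat)
  finally show ?thesis .
qed

text \<open>The hypothesis \<open>dom\<close> says that \<open>F\<close> stochastically dominates
  \<open>G\<close> scaled by \<open>c\<close>. Coupling both through the same uniform variables
  turns this into a pointwise inequality of value profiles.\<close>

lemma RevVCG_dominance:
  assumes F: "real_distribution F" and G: "real_distribution G"
    and "c > 0" and dom: "\<And>v. lcdf F (c * v) \<le> lcdf G v" and "m \<le> N"
  shows "ennreal c * RevVCG m N G \<le> RevVCG m N F"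
proof -
  interpret F: cdf_distribution F unfolding cdf_distribution_def by fact
  interpret G: cdf_distribution G unfolding cdf_distribution_def by fact
  let ?U = "restrict_space lborel {0<..<1::real}"
  \<comment> \<open>\<open>X\<close> and \<open>Y\<close> are the quantile functions; they push the
    uniform measure on the open unit interval forward to \<open>F\<close> and
    \<open>G\<close>.\<close>
  define X where "X \<omega> = Inf {x. \<omega> \<le> cdf F x}" for \<omega>
  define Y where "Y \<omega> = Inf {x. \<omega> \<le> cdf G x}" for \<omega>
  have prob: "prob_space ?U"
    by (auto simp: emeasure_restrict_space space_restrict_space intro!: prob_spaceI)
  have sets: "sets ?U = sets (restrict_space borel {0<..<1})"
    by (simp add: sets_restrict_space)
  have [measurable]: "X \<in> borel_measurable ?U" "Y \<in> borel_measurable ?U"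
    using F.measurable_CI G.measurable_CI
    unfolding X_def[abs_def] Y_def[abs_def] measurable_cong_sets[OF sets refl] by auto
  have dX: "distr ?U borel X = F" and dY: "distr ?U borel Y = G"
    using F.distr_I_eq_M G.distr_I_eq_M by (simp_all add: X_def[abs_def] Y_def[abs_def])
  \<comment> \<open>The quantile functions belong to the right-continuous \<open>cdf\<close>. For
    \<open>y > v\<close>, \<open>lcdf\<close> at \<open>y\<close> lies between \<open>cdf\<close> at
    \<open>v\<close> and \<open>cdf\<close> at \<open>y\<close>; then \<open>y\<close> decreases to
    \<open>v\<close>.\<close>
  have cdf_dom: "cdf F (c * v) \<le> cdf G v" for v
  proof (rule tendsto_le)
    have c: "(cdf G \<longlongrightarrow> cdf G v) (at_right v)"
      using G.cdf_is_right_cont by (simp add: continuous_within)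
    then show "(cdf G \<longlongrightarrow> cdf G v) (at_right v)" .
    show "((\<lambda>_. cdf F (c * v)) \<longlongrightarrow> cdf F (c * v)) (at_right v)" by simp
    have "cdf F (c * v) \<le> cdf G y" if "y > v" for y
    proof -
      have "cdf F (c * v) \<le> lcdf F (c * y)"
        unfolding cdf_def lcdf_def using mult_strict_left_mono[OF that \<open>c > 0\<close>]
        by (intro F.finite_measure_mono) auto
      also have "\<dots> \<le> lcdf G y" by (rule dom)
      also have "\<dots> \<le> cdf G y"
        unfolding cdf_def lcdf_def by (intro G.finite_measure_mono) auto
      finally show ?thesis .
    qed
    then show "\<forall>\<^sub>F y in at_right v. cdf F (c * v) \<le> cdf G y"
      by (auto simp: eventually_at_filter)
  qed simp
  have XY: "c * Y \<omega> \<le> X \<omega>" if "\<omega> \<in> {0<..<1}" for \<omega>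
  proof -
    have "\<omega> \<le> cdf F (X \<omega>)"
      using F.pseudoinverse[of \<omega> "X \<omega>"] that by (simp add: X_def)
    also have "\<dots> \<le> cdf G (X \<omega> / c)" using cdf_dom[of "X \<omega> / c"] \<open>c > 0\<close> by simp
    finally have "Y \<omega> \<le> X \<omega> / c"
      using G.pseudoinverse[of \<omega> "X \<omega> / c"] that by (simp add: Y_def)
    then show ?thesis using \<open>c > 0\<close> by (simp add: field_simps)
  qed
  let ?P = "\<Pi>\<^sub>M i\<in>{..<N}. ?U"
  \<comment> \<open>A product of pushforwards is the pushforward of the product under the
    coordinatewise map, so both revenues become integrals over \<open>?P\<close>.\<close>
  have pull: "(\<integral>\<^sup>+ v. ennreal (next_value m N v) \<partial>(\<Pi>\<^sub>M i\<in>{..<N}. H))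
      = (\<integral>\<^sup>+ u. ennreal (next_value m N (compose {..<N} Z u)) \<partial>?P)"
    if [measurable]: "Z \<in> borel_measurable ?U" and "distr ?U borel Z = H" for Z H
  proof -
    interpret U: prob_space ?U by fact
    interpret UZ: prob_space "distr ?U borel Z" by (rule U.prob_space_distr) simp
    have H: "(\<Pi>\<^sub>M i\<in>{..<N}. H) = distr ?P (\<Pi>\<^sub>M i\<in>{..<N}. distr ?U borel Z) (compose {..<N} Z)"
      using prob that(2)
      by (subst distr_PiM_finite_prob_space')
         (auto simp: UZ.prob_space_axioms intro!: PiM_cong simp flip: that(2) cong: distr_cong)
    have m: "next_value m N \<in> borel_measurable (\<Pi>\<^sub>M i\<in>{..<N}. distr ?U borel Z)"
      using next_value_measurable[of m N]
      by (subst measurable_cong_sets[OF sets_PiM_cong[OF refl] refl, of _ _ "\<lambda>_. borel"]) auto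
    have c: "compose {..<N} Z \<in> measurable ?P (\<Pi>\<^sub>M i\<in>{..<N}. distr ?U borel Z)"
      unfolding compose_def by measurable
    show ?thesis
      unfolding H using m c by (subst nn_integral_distr) auto
  qed
  have "ennreal c * (\<integral>\<^sup>+ u. ennreal (next_value m N (compose {..<N} Y u)) \<partial>?P)
      \<le> (\<integral>\<^sup>+ u. ennreal (next_value m N (compose {..<N} X u)) \<partial>?P)"
  proof -
    have [measurable]: "(\<lambda>u. next_value m N (compose {..<N} Y u)) \<in> borel_measurable ?P"
      by (rule measurable_compose[OF _ next_value_measurable]) (simp add: compose_def)
    have "ennreal c * (\<integral>\<^sup>+ u. ennreal (next_value m N (compose {..<N} Y u)) \<partial>?P)
        = (\<integral>\<^sup>+ u. ennreal (c * next_value m N (compose {..<N} Y u)) \<partial>?P)"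
      using \<open>c > 0\<close> by (simp add: ennreal_mult' nn_integral_cmult)
    also have "\<dots> \<le> (\<integral>\<^sup>+ u. ennreal (next_value m N (compose {..<N} X u)) \<partial>?P)"
      using \<open>c > 0\<close> XY
      by (intro nn_integral_mono ennreal_leI next_value_scale_le)
         (auto simp: compose_def space_PiM space_restrict_space PiE_iff)
    finally show ?thesis .
  qed
  then show ?thesis
    unfolding RevVCG_eq[OF \<open>m \<le> N\<close> F.events_eq_borel] RevVCG_eq[OF \<open>m \<le> N\<close> G.events_eq_borel]
      pull[OF \<open>X \<in> _\<close> dX] pull[OF \<open>Y \<in> _\<close> dY]
    by (metis mult.left_commute mult_left_mono zero_le)
qed

section \<open>Survival functions of MHR distributions\<close>

text \<open>The complement of the support is covered by open null sets, and a countable basis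
  reduces the cover to countably many of them.\<close>

lemma emeasure_compl_supp:
  assumes "sets F = sets borel"
  shows "emeasure F (- supp F) = 0"
proof -
  obtain B :: "real set set" where B: "countable B" "topological_basis B"
    using ex_countable_basis by blast
  let ?C = "{U \<in> B. emeasure F U = 0}"
  have "- supp F = (\<Union>U\<in>?C. U)"
  proof safe
    fix x assume "x \<notin> supp F"
    then obtain U where U: "open U" "x \<in> U" "emeasure F U = 0"
      by (auto simp: supp_def zero_less_iff_neq_zero)
    then obtain V where V: "V \<in> B" "x \<in> V" "V \<subseteq> U"
      using topological_basisE[OF B(2)] by metis
    have "emeasure F V \<le> emeasure F U"
      using U V assms by (intro emeasure_mono) auto
    then show "x \<in> (\<Union>U\<in>?C. U)" using U V by auto
  next
    fix x U assume U: "x \<in> supp F" "x \<in> U" "U \<in> B" "emeasure F U = 0"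
    have "open U" using topological_basis_open[OF B(2) U(3)] .
    then have "0 < emeasure F U" using U(1,2) unfolding supp_def by blast
    then show False using U(4) by simp
  qed
  moreover have "U \<in> sets F" if "U \<in> B" for U
    using topological_basis_open[OF B(2) that] assms by simp
  moreover have "(\<Union>U\<in>?C. U) \<in> null_sets F"
    using B(1) calculation(2) by (intro null_sets_UN') (auto intro!: null_setsI)
  ultimately show ?thesis by (simp only: null_setsD1)
qed

lemma (in real_distribution) measure_Ico:
  "a \<le> b \<Longrightarrow> measure M {a..<b} = lcdf M b - lcdf M a"
proof -
  assume "a \<le> b"
  then have "measure M ({..<b} - {..<a}) = measure M {..<b} - measure M {..<a}"
    by (intro finite_measure_Diff) auto
  moreover have "{..<b} - {..<a} = {a..<b}" by auto
  ultimately show ?thesis by (simp add: lcdf_def)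
qed

lemma closed_supp: "closed (supp F)"
proof -
  have "open (- supp F)"
    by (subst open_subopen) (auto simp: supp_def)
  then show ?thesis by (simp add: closed_def)
qed

text \<open>The value \<open>v = 0\<close> is included even if \<open>F\<close> has an atom at 0,
  because \<open>lcdf\<close> counts only points strictly below \<open>v\<close>.\<close>

lemma lcdf_nonpos:
  assumes "real_distribution F" "AE x in F. 0 \<le> x" "v \<le> 0"
  shows "lcdf F v = 0"
proof -
  interpret real_distribution F by fact
  have "AE x in F. x \<notin> {..<v}" using assms by auto
  then show ?thesis
    unfolding lcdf_def by (subst prob_eq_0) auto
qed

lemma supp_nonneg:
  assumes "real_distribution F" "AE x in F. 0 \<le> x" "x \<in> supp F"
  shows "0 \<le> x"
proof (rule ccontr)
  interpret real_distribution F by fact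
  assume "\<not> 0 \<le> x"
  then have "emeasure F {..<0} > 0" using assms(3) by (auto simp: supp_def)
  then show False
    using lcdf_nonpos[OF assms(1,2), of 0] by (simp add: emeasure_eq_measure lcdf_def)
qed

section \<open>Exponential estimates from monotone hazard rates\<close>

lemma exp_le_of_power_le:
  fixes A B x :: real
  assumes "\<And>k::nat. k > \<bar>x\<bar> \<Longrightarrow> (1 + x / k) ^ k * A \<le> B"
  shows "exp x * A \<le> B"
proof (rule tendsto_upperbound)
  show "(\<lambda>k::nat. (1 + x / k) ^ k * A) \<longlonglongrightarrow> exp x * A"
    by (intro tendsto_intros tendsto_exp_limit_sequentially)
  have "\<forall>\<^sub>F k in sequentially. real k > \<bar>x\<bar>"
    using filterlim_real_sequentially by (auto simp: filterlim_at_top_dense)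
  then show "\<forall>\<^sub>F k in sequentially. (1 + x / real k) ^ k * A \<le> B"
    by (rule eventually_mono) (rule assms)
qed simp

text \<open>Discrete forms of Gronwall's inequality: a first order estimate on the relative decrease
  of \<open>S\<close> is iterated over a partition into \<open>k\<close> equal steps, and \<open>k \<rightarrow> \<infinity>\<close>.\<close>

lemma exp_decay_upper:
  fixes S :: "real \<Rightarrow> real"
  assumes "a \<le> b" "0 \<le> c"
    and step: "\<And>s t. a \<le> s \<Longrightarrow> s \<le> t \<Longrightarrow> t \<le> b \<Longrightarrow> (1 + c * (t - s)) * S t \<le> S s"
  shows "exp (c * (b - a)) * S b \<le> S a"
proof (rule exp_le_of_power_le)
  fix k :: nat assume "k > \<bar>c * (b - a)\<bar>"
  then have k: "k > 0" using gr0I by force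
  define d where "d = (b - a) / k"
  have d: "d \<ge> 0" "k * d = b - a" using assms k by (auto simp: d_def)
  \<comment> \<open>The iteration runs leftwards from \<open>b\<close>, gaining a factor
    \<open>1 + c * d\<close> per step.\<close>
  have "(1 + c * d) ^ j * S b \<le> S (b - j * d)" if "j \<le> k" for j
    using that
  proof (induction j)
    case (Suc j)
    have le: "real (Suc j) * d \<le> b - a"
      using Suc.prems d by (metis mult_right_mono of_nat_le_iff)
    have "(1 + c * d) ^ Suc j * S b \<le> (1 + c * d) * S (b - j * d)"
      using Suc d \<open>0 \<le> c\<close> mult_left_mono[of "(1 + c * d) ^ j * S b" "S (b - j * d)" "1 + c * d"]
      by (simp add: mult.assoc)
    also have "\<dots> \<le> S (b - Suc j * d)"
      using step[of "b - Suc j * d" "b - j * d"] d le by (simp add: algebra_simps)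
    finally show ?case .
  qed simp
  from this[of k] show "(1 + c * (b - a) / k) ^ k * S b \<le> S a" using d(2) by (simp add: d_def)
qed

lemma exp_decay_lower:
  fixes S :: "real \<Rightarrow> real"
  assumes "a \<le> b" "0 \<le> c"
    and step: "\<And>s t. a \<le> s \<Longrightarrow> s \<le> t \<Longrightarrow> t \<le> b \<Longrightarrow> (1 - c * (t - s)) * S s \<le> S t"
  shows "exp (- c * (b - a)) * S a \<le> S b"
proof (rule exp_le_of_power_le)
  fix k :: nat assume "k > \<bar>- c * (b - a)\<bar>"
  then have k: "k > 0" "c * (b - a) \<le> k" using gr0I by force+
  define d where "d = (b - a) / k"
  have d: "d \<ge> 0" "k * d = b - a" "c * d \<le> 1" using assms k by (auto simp: d_def)
  \<comment> \<open>The iteration runs rightwards from \<open>a\<close>. The choice of large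
    \<open>k\<close> gives \<open>c * d \<le> 1\<close>, so multiplying by \<open>1 - c * d\<close>
    preserves the inequality.\<close>
  have "(1 - c * d) ^ j * S a \<le> S (a + j * d)" if "j \<le> k" for j
    using that
  proof (induction j)
    case (Suc j)
    have le: "real (Suc j) * d \<le> b - a"
      using Suc.prems d by (metis mult_right_mono of_nat_le_iff)
    have "(1 - c * d) ^ Suc j * S a \<le> (1 - c * d) * S (a + j * d)"
      using Suc d mult_left_mono[of "(1 - c * d) ^ j * S a" "S (a + j * d)" "1 - c * d"]
      by (simp add: mult.assoc)
    also have "\<dots> \<le> S (a + Suc j * d)"
      using step[of "a + j * d" "a + Suc j * d"] d le by (simp add: algebra_simps)
    finally show ?case .
  qed simp
  from this[of k] show "(1 + - c * (b - a) / k) ^ k * S a \<le> S b" using d(2) by (simp add: d_def)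
qed

text \<open>The hazard rate \<open>c\<close> at \<open>v\<close> is a pivot: the hazard is at most
  \<open>c\<close> before \<open>v\<close> and at least \<open>c\<close> from \<open>v\<close> to
  \<open>r\<close>. This yields S(v) >= exp(-c v) and S(r) <= S(v) exp(-c (r - v)), and eliminating
  \<open>c\<close> gives the bound.\<close>

lemma MHR_survival_lower_bound:
  assumes "F \<in> MHR" "r \<in> supp F" "0 < v" "v \<le> r" "lcdf F r < 1"
  shows "(1 - lcdf F r) powr (v / r) \<le> 1 - lcdf F v"
proof (cases "v \<in> supp F \<and> v < r")
  case False
  show ?thesis
  proof (cases "v = r")
    case True
    then show ?thesis using assms by simp
  next
    case neq: False
    then have v: "v < r" "v \<notin> supp F" using False assms by auto
    have real: "real_distribution F" and int: "is_interval (supp F)"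
      using assms(1) by (auto simp: MHR_def valuation_distribution_def)
    interpret real_distribution F by fact
    \<comment> \<open>Since \<open>r\<close> lies in the support interval and \<open>v < r\<close>
      does not, the whole support lies above \<open>v\<close>; hence no mass is below
      \<open>v\<close>.\<close>
    have "{..<v} \<subseteq> - supp F"
    proof
      fix x assume "x \<in> {..<v}"
      then show "x \<in> - supp F"
        using v mem_is_interval_1_I[OF int _ assms(2), of x v] by auto
    qed
    moreover have "- supp F \<in> sets F"
      using borel_closed[OF closed_supp] by (simp add: borel_comp)
    ultimately have "emeasure F {..<v} \<le> 0"
      using emeasure_compl_supp[OF events_eq_borel] by (metis emeasure_mono)
    then have "lcdf F v = 0" by (simp add: lcdf_def measure_def)
    then show ?thesis
      using assms by (auto simp: lcdf_def intro!: powr_le1)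
  qed
next
  case True
  then have vs: "v \<in> supp F" "v < r" by auto
  from assms(1) obtain f where real: "real_distribution F" and nonneg: "AE x in F. 0 \<le> x"
    and int: "is_interval (supp F)"
    and f: "is_supp_density F f" and mono: "mono_on (supp_body F) (\<lambda>v. f v / (1 - lcdf F v))"
    by (auto simp: MHR_def valuation_distribution_def)
  interpret real_distribution F by fact
  define S where "S t = 1 - lcdf F t" for t
  define c where "c = f v / S v"
  have dec: "S t \<le> S s" if "s \<le> t" for s t
    using that by (auto simp: S_def lcdf_def intro!: finite_measure_mono)
  have pos: "0 < S t" if "t \<le> r" for t
    using dec[OF that] assms(5) by (simp add: S_def)
  have f0: "0 \<le> f x" for x using f by (simp add: is_supp_density_def)
  have [measurable]: "f \<in> borel_measurable borel" using f by (simp add: is_supp_density_def)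
  have [measurable]: "supp F \<in> sets borel" by (rule borel_closed[OF closed_supp])
  have c: "0 \<le> c" using f0 pos[of v] vs by (simp add: c_def)
  have body: "x \<in> supp_body F" if "x \<in> supp F" "x < r" for x
    using that assms(2) by (auto simp: supp_body_def)
  \<comment> \<open>Half-open intervals with \<open>t \<le> r\<close> stay strictly below
    \<open>r\<close>, so their part in the support lies in \<open>supp_body\<close> and a possible
    atom at the right endpoint is avoided.\<close>
  have diff: "ennreal (S s - S t) = (\<integral>\<^sup>+ x \<in> ({s..<t} \<inter> supp F). ennreal (f x) \<partial>lborel)"
    if "s \<le> t" "t \<le> r" for s t
  proof -
    have "S s - S t = measure F {s..<t}"
      using that by (simp add: S_def measure_Ico)
    then have "ennreal (S s - S t) = emeasure F {s..<t}" unfolding emeasure_eq_measure by simp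
    also have "\<dots> = emeasure F ({s..<t} \<inter> supp F)"
    proof (rule emeasure_eq_AE)
      have "- supp F \<in> null_sets F"
        using emeasure_compl_supp[OF events_eq_borel] by (intro null_setsI) (simp_all add: borel_comp)
      then have "AE x in F. x \<notin> - supp F" by (rule AE_not_in)
      then show "AE x in F. (x \<in> {s..<t}) = (x \<in> {s..<t} \<inter> supp F)"
        by (rule AE_mp) simp
    qed simp_all
    also have "\<dots> = (\<integral>\<^sup>+ x \<in> ({s..<t} \<inter> supp F). ennreal (f x) \<partial>lborel)"
    proof -
      have "{s..<t} \<inter> supp F \<in> sets borel" by measurable
      moreover have "{s..<t} \<inter> supp F \<subseteq> supp_body F" using body that by auto
      ultimately show ?thesis using f unfolding is_supp_density_def by blast
    qed
    finally show ?thesis .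
  qed
  have haz: "(f x / S x) * S x = f x" if "x < r" for x
    using pos[of x] that by simp
  \<comment> \<open>Between \<open>v\<close> and \<open>r\<close> every point is in the support, the
    hazard is at least \<open>c\<close> and the survival is at least \<open>S t\<close>, so the
    density is at least \<open>c * S t\<close>.\<close>
  have lower: "(1 + c * (t - s)) * S t \<le> S s" if st: "v \<le> s" "s \<le> t" "t \<le> r" for s t
  proof -
    have "ennreal (c * S t * (t - s)) = (\<integral>\<^sup>+ x \<in> {s..<t}. ennreal (c * S t) \<partial>lborel)"
      using st c pos[of t] by (simp add: nn_integral_cmult_indicator ennreal_mult)
    also have "\<dots> \<le> (\<integral>\<^sup>+ x \<in> ({s..<t} \<inter> supp F). ennreal (f x) \<partial>lborel)"
    proof (rule nn_integral_mono)
      fix x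
      have "ennreal (c * S t) \<le> ennreal (f x)" "x \<in> supp F" if x: "x \<in> {s..<t}"
      proof -
        show xs: "x \<in> supp F"
          using int vs(1) assms(2) x st unfolding is_interval_1
          by (meson atLeastLessThan_iff less_imp_le order_trans)
        have "c \<le> f x / S x"
          unfolding c_def S_def using body[OF xs] body[of v] vs x st
          by (intro mono_onD[OF mono]) auto
        then have "c * S t \<le> (f x / S x) * S x"
          using c x pos[of t] st dec[of x t] by (intro mult_mono) (auto intro: order_trans)
        then show "ennreal (c * S t) \<le> ennreal (f x)"
          using haz[of x] x st by (auto intro!: ennreal_leI)
      qed
      then show "ennreal (c * S t) * indicator {s..<t} x
          \<le> ennreal (f x) * indicator ({s..<t} \<inter> supp F) x"
        by (auto simp: indicator_def)
    qed
    also have "\<dots> = ennreal (S s - S t)" using diff st by simp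
    finally have "c * S t * (t - s) \<le> S s - S t" using dec st by (simp add: ennreal_le_iff)
    then show ?thesis by (simp add: algebra_simps)
  qed
  \<comment> \<open>Left of \<open>v\<close> the density is at most \<open>c * S s\<close> on the
    support; points outside the support only help, as they carry no mass.\<close>
  have upper: "(1 - c * (t - s)) * S s \<le> S t" if st: "s \<le> t" "t \<le> v" for s t
  proof -
    have "ennreal (S s - S t) = (\<integral>\<^sup>+ x \<in> ({s..<t} \<inter> supp F). ennreal (f x) \<partial>lborel)"
      using diff st vs by simp
    also have "\<dots> \<le> (\<integral>\<^sup>+ x \<in> {s..<t}. ennreal (c * S s) \<partial>lborel)"
    proof (rule nn_integral_mono)
      fix x
      have "ennreal (f x) \<le> ennreal (c * S s)" if x: "x \<in> {s..<t}" "x \<in> supp F"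
      proof -
        have "f x / S x \<le> c"
          unfolding c_def S_def using body[of x] body[of v] vs x st
          by (intro mono_onD[OF mono]) auto
        then have "(f x / S x) * S x \<le> c * S s"
          using c x pos[of x] st vs dec[of s x] by (intro mult_mono) auto
        then show ?thesis
          using haz[of x] x vs st by (auto intro!: ennreal_leI)
      qed
      then show "ennreal (f x) * indicator ({s..<t} \<inter> supp F) x
          \<le> ennreal (c * S s) * indicator {s..<t} x"
        by (auto simp: indicator_def)
    qed
    also have "\<dots> = ennreal (c * S s * (t - s))"
      using st c pos[of s] vs by (simp add: nn_integral_cmult_indicator ennreal_mult)
    finally have "S s - S t \<le> c * S s * (t - s)"
      using c pos[of s] st vs by (simp add: ennreal_le_iff)
    then show ?thesis by (simp add: algebra_simps)
  qed
  have "exp (c * (r - v)) * S r \<le> S v"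
    using vs by (intro exp_decay_upper[OF _ c] lower) auto
  then have "ln (exp (c * (r - v)) * S r) \<le> ln (S v)"
    using pos vs by (subst ln_le_cancel_iff) auto
  then have 1: "c * (r - v) + ln (S r) \<le> ln (S v)"
    using pos[of r] by (simp add: ln_mult)
  have "S 0 = 1" using lcdf_nonpos[OF real nonneg, of 0] by (simp add: S_def)
  then have "exp (- c * v) \<le> S v"
    using exp_decay_lower[of 0 v c S, OF _ c upper] assms(3) by simp
  then have "ln (exp (- c * v)) \<le> ln (S v)"
    using pos vs by (subst ln_le_cancel_iff) auto
  then have 2: "- c * v \<le> ln (S v)" by simp
  \<comment> \<open>Adding \<open>v\<close> times estimate \<open>1\<close> and \<open>r - v\<close>
    times estimate \<open>2\<close> cancels \<open>c\<close>.\<close>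
  have "v * ln (S r) \<le> v * (ln (S v) - c * (r - v))"
    using 1 assms(3) by (intro mult_left_mono) auto
  also have "\<dots> \<le> r * ln (S v)"
    using mult_left_mono[OF 2, of "r - v"] vs by (simp add: algebra_simps)
  finally have "v / r * ln (S r) \<le> ln (S v)"
    using vs assms(3) by (simp add: field_simps)
  then have "exp (v / r * ln (S r)) \<le> exp (ln (S v))" by (simp only: exp_le_cancel_iff)
  also have "\<dots> = S v" using pos[of v] vs by simp
  finally show ?thesis
    using pos[of r] by (simp add: powr_def S_def)
qed

text \<open>The reserve \<open>s\<close> is compared with the slightly lower price
  \<open>t * s\<close>, whose sale probability is bounded below by the survival estimate. Taking
  logarithms gives (1 - t) L <= ln (1 / t) <= (1 - t) / t, hence L <= 1 / t, and t tends to
  1.\<close>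

lemma monopoly_reserve_survival:
  assumes F: "F \<in> MHR" and s: "monopoly_reserve F s" "0 < s" "lcdf F s < 1"
  shows "exp (- 1) \<le> 1 - lcdf F s"
proof -
  define L where "L = - ln (1 - lcdf F s)"
  have ss: "s \<in> supp F" using s(1) by (simp add: monopoly_reserve_def)
  have pos: "0 < 1 - lcdf F s" using s(3) by simp
  have "t * L \<le> 1" if t: "0 < t" "t < 1" for t
  proof -
    have "t * s * (1 - lcdf F s) powr t \<le> t * s * (1 - lcdf F (t * s))"
      using MHR_survival_lower_bound[OF F ss _ _ s(3), of "t * s"] s(2) t
      by (intro mult_left_mono) auto
    also have "\<dots> \<le> s * (1 - lcdf F s)"
      using s(1,2) t by (simp add: monopoly_reserve_def)
    finally have "s * (t * (1 - lcdf F s) powr t) \<le> s * (1 - lcdf F s)"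
      by (simp only: ac_simps)
    then have "t * (1 - lcdf F s) powr t \<le> 1 - lcdf F s"
      using s(2) by (rule mult_left_le_imp_le)
    then have "ln (t * (1 - lcdf F s) powr t) \<le> ln (1 - lcdf F s)"
      using t pos by (subst ln_le_cancel_iff) auto
    moreover have "ln (t * (1 - lcdf F s) powr t) = ln t + t * ln (1 - lcdf F s)"
      using t pos by (subst ln_mult) (auto simp: ln_powr)
    ultimately have "ln t + t * ln (1 - lcdf F s) \<le> ln (1 - lcdf F s)" by (simp only:)
    moreover have "ln (1 / t) = - ln t" using t by (simp add: ln_div)
    moreover have "(1 - t) * L = t * ln (1 - lcdf F s) - ln (1 - lcdf F s)"
      unfolding L_def by (simp add: left_diff_distrib)
    ultimately have "(1 - t) * L \<le> ln (1 / t)" by linarith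
    also have "\<dots> \<le> 1 / t - 1" using t by (intro ln_le_minus_one) auto
    also have "\<dots> = (1 - t) * (1 / t)" using t by (simp add: field_simps)
    finally have "L \<le> 1 / t" using t by (intro mult_left_le_imp_le[of "1 - t" L]) simp_all
    then show ?thesis using t by (simp add: field_simps)
  qed
  then have "L \<le> 1" by (rule field_le_mult_one_interval)
  then have "exp (- 1) \<le> exp (ln (1 - lcdf F s))" unfolding L_def by (subst exp_le_cancel_iff) linarith
  then show ?thesis unfolding exp_ln[OF pos] .
qed

section \<open>Truncated exponential distributions\<close>

lemma texp_lcdf:
  assumes "is_texp r F" "1 \<le> r"
  shows "real_distribution F" "v \<in> {0..r} \<Longrightarrow> lcdf F v = 1 - r powr (- v / r)"
    "v > r \<Longrightarrow> lcdf F v = 1" "v \<le> 0 \<Longrightarrow> lcdf F v = 0" "lcdf F r = 1 - 1 / r"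
proof -
  show real: "real_distribution F" and eq: "v \<in> {0..r} \<Longrightarrow> lcdf F v = 1 - r powr (- v / r)" for v
    using assms by (auto simp: is_texp_def)
  show "v > r \<Longrightarrow> lcdf F v = 1" using assms by (auto simp: is_texp_def)
  show "lcdf F r = 1 - 1 / r"
    using eq[of r] assms by (simp add: powr_minus_divide)
  interpret real_distribution F by fact
  show "lcdf F v = 0" if "v \<le> 0"
  proof -
    have "lcdf F v \<le> lcdf F 0"
      unfolding lcdf_def using that by (intro finite_measure_mono) auto
    also have "lcdf F 0 = 0" using eq[of 0] assms by simp
    finally show ?thesis using measure_nonneg[of F "{..<v}"] by (simp add: lcdf_def)
  qed
qed

text \<open>Growth to the right of \<open>x\<close> suffices, and it also detects an atom at
  \<open>x\<close>: \<open>lcdf\<close> at \<open>x\<close> leaves that atom out, while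
  \<open>lcdf\<close> at any larger point includes it.\<close>

lemma in_suppI:
  assumes "real_distribution F" "\<And>y. x < y \<Longrightarrow> lcdf F x < lcdf F y"
  shows "x \<in> supp F"
  unfolding supp_def
proof safe
  interpret real_distribution F by fact
  fix U assume "open U" "x \<in> U"
  then obtain e where e: "e > 0" "ball x e \<subseteq> U" by (meson openE)
  have "{x..<x + e} \<subseteq> ball x e" by (auto simp: dist_real_def)
  then have "emeasure F {x..<x + e} \<le> emeasure F U"
    using e \<open>open U\<close> by (intro emeasure_mono) auto
  moreover have "measure F {x..<x + e} > 0"
    using measure_Ico[of x "x + e"] assms(2)[of "x + e"] e by simp
  ultimately show "emeasure F U > 0"
    by (simp add: emeasure_eq_measure)
qed

lemma not_in_suppI:
  assumes "real_distribution F" "a \<le> b" "x \<in> {a<..<b}" "lcdf F a = lcdf F b"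
  shows "x \<notin> supp F"
proof -
  interpret real_distribution F by fact
  have "emeasure F {a<..<b} \<le> emeasure F {a..<b}" by (intro emeasure_mono) auto
  also have "\<dots> = 0" using assms by (simp add: emeasure_eq_measure measure_Ico)
  finally show ?thesis using assms(3) by (auto simp: supp_def intro!: exI[of _ "{a<..<b}"])
qed

lemma texp_powr_less:
  assumes "1 < (r::real)" "x < y"
  shows "r powr (- y / r) < r powr (- x / r)"
  using assms by (intro powr_less_mono) (auto intro: divide_strict_right_mono)

text \<open>For \<open>r = 1\<close> the powers are constantly 1, so \<open>lcdf\<close> vanishes up
  to 1 and the distribution degenerates to the point mass at 1.\<close>

lemma texp_supp:
  assumes F: "is_texp r F" and "1 \<le> r"
  shows "supp F = (if r = 1 then {1} else {0..r})"
proof -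
  note L = texp_lcdf[OF F \<open>1 \<le> r\<close>]
  have "x \<notin> supp F" if "x < 0" for x
    using that L(4)[of "x - 1"] L(4)[of 0] by (intro not_in_suppI[OF L(1), of "x - 1" 0]) auto
  moreover have "x \<notin> supp F" if "r < x" for x
  proof (rule not_in_suppI[OF L(1), of "(r + x) / 2" "x + 1"])
    show "lcdf F ((r + x) / 2) = lcdf F (x + 1)"
      using that L(3)[of "(r + x) / 2"] L(3)[of "x + 1"] by simp
  qed (use that in auto)
  moreover have "r \<in> supp F"
    using \<open>1 \<le> r\<close> L(3,5) by (intro in_suppI[OF L(1)]) auto
  moreover have "x \<in> supp F" if "0 \<le> x" "x < r" "r \<noteq> 1" for x
  proof (rule in_suppI[OF L(1)])
    fix y assume "x < y"
    show "lcdf F x < lcdf F y"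
    proof (cases "y \<le> r")
      case True
      then show ?thesis
        using that \<open>x < y\<close> \<open>1 \<le> r\<close> L(2)[of x] L(2)[of y] texp_powr_less[of r x y] by simp
    next
      case False
      then show ?thesis using that \<open>1 \<le> r\<close> L(2)[of x] L(3)[of y] by simp
    qed
  qed
  moreover have "x \<notin> supp F" if "0 \<le> x" "x < r" "r = 1" for x
    using that L(4)[of "-1"] L(5) by (intro not_in_suppI[OF L(1), of "-1" 1]) auto
  ultimately show ?thesis
    by (auto simp: not_less[symmetric]) (metis less_eq_real_def linorder_less_linear)+
qed

lemma texp_supp_body:
  assumes "is_texp r F" "1 \<le> r"
  shows "supp_body F = (if r = 1 then {} else {0..<r})"
  unfolding supp_body_def texp_supp[OF assms] using assms(2)
  by (auto intro: bexI[of _ r])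

lemma texp_density:
  assumes F: "is_texp r F" and "1 \<le> r"
  shows "is_supp_density F (\<lambda>x. ln r / r * r powr (- x / r))"
proof -
  note L = texp_lcdf[OF F \<open>1 \<le> r\<close>]
  interpret real_distribution F by (rule L(1))
  let ?f = "\<lambda>x. ln r / r * r powr (- x / r)"
  have f0: "0 \<le> ?f x" for x using \<open>1 \<le> r\<close> by simp
  have "emeasure F A = (\<integral>\<^sup>+ x \<in> A. ennreal (?f x) \<partial>lborel)"
    if A: "A \<in> sets borel" "A \<subseteq> supp_body F" for A
  proof (cases "r = 1")
    case True
    then show ?thesis using A texp_supp_body[OF F \<open>1 \<le> r\<close>] by simp
  next
    case False
    then have "1 < r" using \<open>1 \<le> r\<close> by simp
    \<comment> \<open>\<open>G\<close> is \<open>F\<close> restricted to the half-open interval,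
      which removes the atom at \<open>r\<close>; it is compared with the candidate \<open>H\<close>
      on open rays.\<close>
    define G where "G = density F (indicator {0..<r})"
    define H where "H = density lborel (\<lambda>x. ennreal (?f x) * indicator {0..<r} x)"
    have deriv: "((\<lambda>x. - (r powr (- x / r))) has_real_derivative ?f x) (at x)" for x
      using \<open>1 < r\<close> by (auto intro!: derivative_eq_intros simp: field_simps)
    have "G = H"
    proof (rule measure_eqI_lessThan)
      fix x :: real
      have "emeasure G {x<..} = emeasure F ({0..<r} \<inter> {x<..})"
        unfolding G_def by (simp add: emeasure_density nn_integral_indicator flip: indicator_inter_arith)
      also have "\<dots> = emeasure F {max 0 x..<r}"
      proof (rule emeasure_eq_AE)
        \<comment> \<open>The open ray omits \<open>x\<close> while \<open>measure_Ico\<close>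
          includes it. There is no atom below \<open>r\<close>, since the mass of
          \<open>{x..<y}\<close> tends to 0 as \<open>y\<close> decreases to
          \<open>x\<close>.\<close>
        have "emeasure F {x} = 0" if "0 \<le> x" "x < r"
        proof -
          have "measure F {x} \<le> lcdf F y - lcdf F x" if "x < y" for y
            using measure_Ico[of x y] finite_measure_mono[of "{x}" "{x..<y}"] that by simp
          then have "measure F {x} \<le> r powr (- x / r) - r powr (- y / r)" if "x < y" "y < r" for y
            using L(2)[of x] L(2)[of y] that \<open>0 \<le> x\<close> by force
          then have "\<forall>\<^sub>F y in at_right x. measure F {x} \<le> r powr (- x / r) - r powr (- y / r)"
            using \<open>x < r\<close> eventually_at_right_real[OF \<open>x < r\<close>] by (auto elim: eventually_mono)
          moreover have "((\<lambda>y. r powr (- x / r) - r powr (- y / r))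
              \<longlongrightarrow> r powr (- x / r) - r powr (- x / r)) (at_right x)"
            using \<open>1 < r\<close> by (intro tendsto_intros) auto
          ultimately have "measure F {x} \<le> r powr (- x / r) - r powr (- x / r)"
            by (intro tendsto_lowerbound) auto
          then show ?thesis using measure_nonneg[of F "{x}"] by (simp add: emeasure_eq_measure)
        qed
        then have "AE y in F. \<not> (0 \<le> x \<and> x < r \<and> y = x)"
          by (cases "0 \<le> x \<and> x < r") (auto intro!: AE_I[of _ _ "{x}"])
        then show "AE y in F. (y \<in> {0..<r} \<inter> {x<..}) = (y \<in> {max 0 x..<r})"
          by eventually_elim auto
      qed auto
      also have "\<dots> = (\<integral>\<^sup>+ y. ennreal (?f y) * indicator {max 0 x..<r} y \<partial>lborel)"
      proof (cases "x < r")
        case True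
        have "(\<integral>\<^sup>+ y. ennreal (?f y) * indicator {max 0 x..<r} y \<partial>lborel)
            = (\<integral>\<^sup>+ y. ennreal (?f y) * indicator {max 0 x..r} y \<partial>lborel)"
          using AE_lborel_singleton[of r]
          by (intro nn_integral_cong_AE) (auto elim!: eventually_mono simp: indicator_def)
        also have "\<dots> = ennreal (- (r powr (- r / r)) - (- (r powr (- max 0 x / r))))"
          using True \<open>1 < r\<close> f0 deriv
          by (intro nn_integral_FTC_Icc) (auto intro: DERIV_subset)
        also have "\<dots> = ennreal (lcdf F r - lcdf F (max 0 x))"
          using True \<open>1 < r\<close> L(2)[of r] L(2)[of "max 0 x"] by simp
        also have "\<dots> = emeasure F {max 0 x..<r}"
          using True \<open>1 < r\<close> by (simp add: emeasure_eq_measure measure_Ico)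
        finally show ?thesis ..
      qed auto
      also have "\<dots> = emeasure H {x<..}"
        unfolding H_def
        by (subst emeasure_density, simp, simp, rule nn_integral_cong_AE)
           (use AE_lborel_singleton[of x] in \<open>auto elim!: eventually_mono simp: indicator_def\<close>)
      finally show "emeasure G {x<..} = emeasure H {x<..}" .
      show "emeasure G {x<..} < \<infinity>"
        unfolding \<open>emeasure G {x<..} = emeasure F ({0..<r} \<inter> {x<..})\<close>
        by (simp add: emeasure_eq_measure)
    qed (auto simp: G_def H_def)
    have sub: "A \<subseteq> {0..<r}" using A False texp_supp_body[OF F \<open>1 \<le> r\<close>] by simp
    then have "emeasure F A = emeasure G A"
      using A unfolding G_def
      by (simp add: emeasure_density Int_absorb1 nn_integral_indicator flip: indicator_inter_arith)
    also have "\<dots> = (\<integral>\<^sup>+ x \<in> A. ennreal (?f x) \<partial>lborel)"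
      using A sub unfolding \<open>G = H\<close> H_def
      by (subst emeasure_density) (auto intro!: nn_integral_cong simp: indicator_def)
    finally show ?thesis .
  qed
  then show ?thesis
    using f0 unfolding is_supp_density_def by auto
qed

text \<open>The price \<open>r\<close> earns exactly 1. For \<open>p \<le> r\<close> the claim p
  r^(-p/r) <= 1 follows from ln x <= x - 1 at x = p/r; the bound \<open>r \<le> exp 1\<close> enters
  through ln r <= 1.\<close>

lemma texp_monopoly_reserve:
  assumes F: "is_texp r F" and "1 \<le> r" "r \<le> exp 1"
  shows "monopoly_reserve F r"
proof -
  note L = texp_lcdf[OF F \<open>1 \<le> r\<close>]
  have "p * (1 - lcdf F p) \<le> 1" if "0 \<le> p" for p
  proof (cases "p = 0 \<or> p > r")
    case True
    then show ?thesis using L(3) by auto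
  next
    case False
    then have p: "0 < p" "p \<le> r" using that by auto
    have "ln r \<le> 1" using \<open>1 \<le> r\<close> \<open>r \<le> exp 1\<close> by (metis less_le_trans ln_exp ln_le_cancel_iff zero_less_one exp_gt_zero)
    have "ln (p / r) \<le> p / r - 1" using p \<open>1 \<le> r\<close> by (intro ln_le_minus_one) auto
    \<comment> \<open>Since \<open>p / r - 1\<close> is nonpositive, shrinking its factor from 1 to
      \<open>ln r\<close> increases the product.\<close>
    also have "\<dots> \<le> (p / r - 1) * ln r"
      using mult_left_mono_neg[OF \<open>ln r \<le> 1\<close>, of "p / r - 1"] p \<open>1 \<le> r\<close> by simp
    finally have "ln p + - p / r * ln r \<le> 0"
      using p \<open>1 \<le> r\<close> by (simp add: ln_div algebra_simps)
    then have "exp (ln p + - p / r * ln r) \<le> 1" by simp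
    then have "p * r powr (- p / r) \<le> 1"
      using p \<open>1 \<le> r\<close> by (simp only: exp_add powr_def) simp
    then show ?thesis using L(2)[of p] p by simp
  qed
  moreover have "r \<in> supp F" using texp_supp[OF F \<open>1 \<le> r\<close>] \<open>1 \<le> r\<close> by simp
  ultimately show ?thesis
    using L(5) \<open>1 \<le> r\<close> by (simp add: monopoly_reserve_def)
qed

lemma TEXP_subset_MHR: "TEXP \<subseteq> MHR"
proof
  fix F assume "F \<in> TEXP"
  then obtain r where r: "1 \<le> r" "r \<le> exp 1" and F: "is_texp r F" by (auto simp: TEXP_def)
  note L = texp_lcdf[OF F \<open>1 \<le> r\<close>]
  interpret real_distribution F by (rule L(1))
  have "AE x in F. 0 \<le> x"
    using L(4)[of 0] by (intro AE_I[of _ _ "{..<0}"]) (auto simp: lcdf_def emeasure_eq_measure)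
  moreover have "is_interval (supp F)"
    using r by (auto simp: texp_supp[OF F] is_interval_1)
  \<comment> \<open>Density and survival are both multiples of the same power, so the hazard rate is
    the constant \<open>ln r / r\<close>.\<close>
  moreover have "mono_on (supp_body F) (\<lambda>v. ln r / r * r powr (- v / r) / (1 - lcdf F v))"
    using r by (auto simp: texp_supp_body[OF F] L(2) intro!: mono_onI)
  ultimately show "F \<in> MHR"
    using texp_density[OF F r(1)] texp_monopoly_reserve[OF F r] L(1)
    by (auto simp: MHR_def valuation_distribution_def)
qed

section \<open>Point masses as witnesses for strict inclusion\<close>

lemma point_mass_in_MHR:
  assumes "0 \<le> a"
  shows "return borel a \<in> MHR"
proof -
  let ?F = "return borel a"
  interpret prob_space ?F by (rule prob_space_return) simp
  have real: "real_distribution ?F"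
    by (simp add: real_distribution_def real_distribution_axioms_def prob_space_axioms)
  have S: "supp ?F = {a}"
  proof safe
    fix x assume "x \<in> supp ?F"
    then have "open (- {a}) \<and> x \<in> - {a} \<longrightarrow> emeasure ?F (- {a}) > 0"
      unfolding supp_def by blast
    then show "x = a" by auto
  qed (auto simp: supp_def)
  have lcdf: "lcdf ?F v = indicator {..<v} a" for v
    by (simp add: lcdf_def measure_return)
  have "AE x in ?F. 0 \<le> x" using assms by (simp add: AE_return)
  moreover have body: "supp_body ?F = {}" by (simp add: supp_body_def S)
  then have "is_supp_density ?F (\<lambda>_. 0)" by (auto simp: is_supp_density_def)
  moreover have "monopoly_reserve ?F a"
    using assms by (auto simp: monopoly_reserve_def S lcdf indicator_def)
  ultimately show ?thesis
    using real by (auto simp: MHR_def valuation_distribution_def S body is_interval_1 intro!: exI[of _ "\<lambda>_. 0"])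
qed

text \<open>A truncated exponential has all its mass at or below e, so its \<open>lcdf\<close> is 1
  at \<open>a\<close>; for the point mass it is 0 there.\<close>

lemma point_mass_notin_TEXP:
  assumes "a > exp 1"
  shows "return borel a \<notin> TEXP"
proof
  assume "return borel a \<in> TEXP"
  then obtain r where "r \<le> exp 1" "is_texp r (return borel a)" by (auto simp: TEXP_def)
  then have "lcdf (return borel a) a = 1" using assms by (auto simp: is_texp_def)
  then show False by (simp add: lcdf_def measure_return)
qed

section \<open>Competition complexity\<close>

lemma RevVCG_ge_if_TEXP:
  assumes texp: "\<And>G r. G \<in> TEXP \<Longrightarrow> monopoly_reserve G r \<Longrightarrow> RevOPT n n r G \<le> RevVCG n (n + k) G"
    and F: "F \<in> MHR" and s: "monopoly_reserve F s"
  shows "RevOPT n n s F \<le> RevVCG n (n + k) F"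
proof -
  have real: "real_distribution F" and nonneg: "AE x in F. 0 \<le> x"
    using F by (auto simp: MHR_def valuation_distribution_def)
  interpret real_distribution F by fact
  have ss: "s \<in> supp F" using s by (simp add: monopoly_reserve_def)
  have s0: "0 \<le> s" by (rule supp_nonneg[OF real nonneg ss])
  define R where "R = s * (1 - lcdf F s)"
  have opt: "RevOPT n n s F = ennreal (real n * R)"
    unfolding R_def by (rule RevOPT_balanced[OF real s0])
  show ?thesis
  proof (cases "0 < R")
    case False
    then have "real n * R \<le> 0" by (simp add: mult_nonneg_nonpos)
    then show ?thesis by (simp add: opt ennreal_neg)
  next
    case True
    then have pos: "0 < s" "lcdf F s < 1" using s0 by (auto simp: R_def zero_less_mult_iff)
    \<comment> \<open>The parameter is chosen so that the \<open>q\<close>-truncated exponential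
      sells at price \<open>q\<close> with the same probability as \<open>F\<close> at
      \<open>s\<close>; the factor \<open>R\<close> then carries \<open>q\<close> to
      \<open>s\<close>.\<close>
    define q where "q = 1 / (1 - lcdf F s)"
    have q1: "1 \<le> q"
      using pos measure_nonneg[of F "{..<s}"] by (simp add: q_def lcdf_def)
    have "1 / (1 - lcdf F s) \<le> 1 / exp (- 1)"
      using monopoly_reserve_survival[OF F s pos] pos by (intro divide_left_mono) (auto intro: mult_pos_pos)
    then have qe: "q \<le> exp 1" by (simp add: q_def exp_minus inverse_eq_divide)
    have sq: "s = R * q" and Sq: "1 - lcdf F s = 1 / q" using pos by (auto simp: R_def q_def)
    obtain G where G: "is_texp q G" using ex_texp[OF q1] by blast
    note L = texp_lcdf[OF G q1]
    have dom: "lcdf F (R * v) \<le> lcdf G v" for v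
    proof -
      consider "v \<le> 0" | "0 < v" "v \<le> q" | "q < v" by linarith
      then show ?thesis
      proof cases
        case 1
        then have "lcdf F (R * v) = 0"
          using True by (intro lcdf_nonpos[OF real nonneg]) (simp add: mult_nonneg_nonpos)
        then show ?thesis by (simp add: lcdf_def)
      next
        case 2
        have "(1 - lcdf F s) powr (R * v / s) \<le> 1 - lcdf F (R * v)"
          using 2 True q1
          by (intro MHR_survival_lower_bound[OF F ss _ _ pos(2)]) (auto simp: sq)
        \<comment> \<open>Here S(s) = 1/q and R v / s = v / q, so the MHR lower bound is precisely
          the survival function of \<open>G\<close>.\<close>
        moreover have "(1 - lcdf F s) powr (R * v / s) = q powr (- v / q)"
          using True q1 by (simp add: Sq) (simp add: sq powr_divide powr_minus_divide)
        ultimately show ?thesis using 2 L(2)[of v] by simp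
      next
        case 3
        then show ?thesis using L(3)[of v] prob_le_1 by (simp add: lcdf_def)
      qed
    qed
    have "G \<in> TEXP" using G q1 qe by (auto simp: TEXP_def)
    then have "RevOPT n n q G \<le> RevVCG n (n + k) G"
      using texp_monopoly_reserve[OF G q1 qe] by (rule texp)
    moreover have "RevOPT n n q G = ennreal (real n)"
      using RevOPT_balanced[OF L(1), of q n] q1 by (simp add: L(5))
    ultimately have "ennreal R * ennreal (real n) \<le> ennreal R * RevVCG n (n + k) G"
      by (intro mult_left_mono) auto
    also have "\<dots> \<le> RevVCG n (n + k) F"
      by (rule RevVCG_dominance[OF real L(1) True dom]) simp
    finally show ?thesis
      using True by (simp add: opt ennreal_mult' mult.commute)
  qed
qed

theorem proposition3p1:
  fixes n :: nat
  assumes "n \<ge> 1"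
  shows "TEXP \<subset> MHR \<and> CC n MHR = CC n TEXP"
proof
  have "return borel (exp 1 + 1) \<in> MHR - TEXP"
    using point_mass_in_MHR[of "exp 1 + 1"] point_mass_notin_TEXP[of "exp 1 + 1"]
    by (simp add: add_nonneg_nonneg)
  then show "TEXP \<subset> MHR" using TEXP_subset_MHR by blast
  \<comment> \<open>The two sets of sufficient \<open>k\<close> coincide: one inclusion is
    restriction to a subclass, the other is the reduction above.\<close>
  show "CC n MHR = CC n TEXP"
    unfolding CC_def using TEXP_subset_MHR RevVCG_ge_if_TEXP[of n]
    by (intro arg_cong[of _ _ "\<lambda>K. Inf (enat ` K)"] Collect_cong) blast
qed

end
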